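(* Let $p, q, k \ge 0$ be real constants, and let $p_i = i^{-p}$, $q_i = i^{q}$, $k_i = i^{-k}$ for all integers $i\ge 1$. Let $p_0, q_0\ge 0$ and $k_0>0$ be given with $p_0+q_0>0$. Set $a := q+k$ and $b := k-p$, and suppose that $a\ge 0$ and $b>-2$. (1) If $b>a-1$, the system (S) in the context has an equilibrium for all values of $\alpha/r$ ($\alpha,r>0$). (2) If $b=a-1$, there is a value $m>0$ such that the system (S) has an equilibrium if $\alpha/r<m$ and no equilibria if $\alpha/r\ge m$. (3) If $b<a-1$, there is a value $m>0$ such that the system (S) has an equilibrium if $\alpha/r\le m$ and no equilibria if $\alpha/r>m$.
   Context: For constants $\alpha, r>0$ and rates $(k_i),(p_i),(q_i)$, $i\ge0$, system (S) is $$\dot M_0 = r - k_0xM_0-(p_0+q_0)M_0,\qquad \dot M_i = k_{i-1}xM_{i-1}-k_ixM_i-(p_i+q_i)M_i\quad (i\ge1),$$ $$\dot x = \alpha - x\sum_{i=0}^\infty k_iM_i+\sum_{i=0}^\infty i q_i M_i.$$ An equilibrium is a stationary solution with $x\ge 0$ (all right-hand sides zero, series convergent). With $d_i := (p_i+q_i)/k_i$ (so $d_i=i^a+i^b$ for $i\ge1$), at an equilibrium necessarily $M_i = \dfrac{r x^i}{k_i\prod_{j=0}^i(x+d_j)}$, and equilibria correspond exactly to real $x\ge0$ with $$\frac{\alpha}{r} = \frac{x}{x+d_0} + \frac{1}{x+d_0}\sum_{i=1}^\infty \left( x - i \frac{q_i}{k_i} \right)\prod_{j=1}^i \frac{x}{x+d_j}.$$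 The number $m$ depends only on the rates, not on $\alpha, r$. *)

theory Defs
  imports Complex_Main
begin

text \<open>
  Right-hand sides of the infinite system for \<open>M 0, M 1, \<dots>\<close> and \<open>x\<close>, with
  rate sequences \<open>k\<close>, \<open>p\<close>, \<open>q\<close> indexed from \<open>0\<close>.
\<close>

definition M_rhs ::
  "real \<Rightarrow> (nat \<Rightarrow> real) \<Rightarrow> (nat \<Rightarrow> real) \<Rightarrow> (nat \<Rightarrow> real) \<Rightarrow> (nat \<Rightarrow> real) \<Rightarrow> real \<Rightarrow> nat \<Rightarrow> real"
where
  "M_rhs r k p q M x i =
     (case i of
        0 \<Rightarrow> r - k 0 * x * M 0 - (p 0 + q 0) * M 0
      | Suc j \<Rightarrow> k j * x * M j - k i * x * M i - (p i + q i) * M i)"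

definition x_rhs ::
  "real \<Rightarrow> (nat \<Rightarrow> real) \<Rightarrow> (nat \<Rightarrow> real) \<Rightarrow> (nat \<Rightarrow> real) \<Rightarrow> real \<Rightarrow> real"
where
  "x_rhs \<alpha> k q M x = \<alpha> - x * (\<Sum>i. k i * M i) + (\<Sum>i. real i * q i * M i)"

text \<open>
  The two summability conditions are needed because \<open>suminf\<close> has an unspecified value on
  divergent series. Nonnegativity of \<open>M\<close> is not imposed: for positive \<open>r\<close>, \<open>k i\<close> and
  \<open>p i + q i\<close> it follows from \<open>x \<ge> 0\<close> and the equations.
\<close>

definition is_equilibrium ::
  "real \<Rightarrow> real \<Rightarrow> (nat \<Rightarrow> real) \<Rightarrow> (nat \<Rightarrow> real) \<Rightarrow> (nat \<Rightarrow> real) \<Rightarrow> (nat \<Rightarrow> real) \<Rightarrow> real \<Rightarrow> bool"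
where
  "is_equilibrium \<alpha> r k p q M x \<longleftrightarrow>
     x \<ge> 0 \<and>
     summable (\<lambda>i. k i * M i) \<and>
     summable (\<lambda>i. real i * q i * M i) \<and>
     (\<forall>i. M_rhs r k p q M x i = 0) \<and>
     x_rhs \<alpha> k q M x = 0"

definition has_equilibrium ::
  "real \<Rightarrow> real \<Rightarrow> (nat \<Rightarrow> real) \<Rightarrow> (nat \<Rightarrow> real) \<Rightarrow> (nat \<Rightarrow> real) \<Rightarrow> bool"
where
  "has_equilibrium \<alpha> r k p q \<longleftrightarrow> (\<exists>M x. is_equilibrium \<alpha> r k p q M x)"

end

theory Submission
  imports Defs "HOL-Analysis.Analysis" "HOL-Real_Asymp.Real_Asymp"
begin

text \<open>
  Read \<open>M i\<close> as the concentration of clusters of size \<open>i\<close> and \<open>x\<close> as that of free monomers. Clusters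
  are born with size \<open>0\<close> at rate \<open>r\<close>. At fixed \<open>x\<close>, a cluster of size \<open>i\<close> grows at rate \<open>k i * x\<close> and
  disappears at rate \<open>p i + q i\<close>, so with \<open>d i = (p i + q i) / k i\<close> it reaches the next size with
  probability \<open>x / (x + d i)\<close>. A cluster that disappears through \<open>q\<close> gives its \<open>i\<close> monomers back,
  while one that disappears through \<open>p\<close> takes them away. At an equilibrium the monomers supplied
  must be those that are taken away. If \<open>I\<close> is the random size at which a cluster disappears, this says
  that \<open>\<alpha> / r\<close> is the mean \<open>F(x)\<close> of \<open>f I\<close>, where \<open>f i = i * p i / (p i + q i)\<close>; compared with the series
  in terms of \<open>q\<close>, this one has only nonnegative terms. The equivalence is lemma
  \<open>has_equilibrium_iff\<close>; its analytic content is the tail formula for the mean of \<open>I\<close>, lemma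
  \<open>mean_exit_sums\<close>, which rewrites the monomer uptake as \<open>r\<close> times that mean.

  So the question is which positive values \<open>F\<close> takes. As the \<open>d i\<close> are bounded below by a positive
  constant, \<open>I\<close> has geometric tails, uniformly for bounded \<open>x\<close>. Together with \<open>\<bar>f i\<bar> \<le> i\<close> this makes \<open>F\<close>
  continuous, and \<open>F(0) = f 0 = 0\<close>. As \<open>x\<close> grows, the probability of every fixed exit size tends to
  \<open>0\<close>, so \<open>I\<close> escapes to infinity and \<open>F\<close> inherits the limiting behaviour of \<open>f\<close>. For the power-law
  rates, \<open>f i = i powr (b + 1) / (i powr a + i powr b)\<close> for positive \<open>i\<close>, which leaves three cases.

  If \<open>b > a - 1\<close>, then \<open>f\<close> and hence \<open>F\<close> tends to infinity, and \<open>F\<close> takes all nonnegative values.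

  If \<open>b = a - 1\<close>, then \<open>f i = i / (i + 1)\<close> increases to \<open>1\<close> and stays below it; so \<open>F\<close> also stays
  strictly below \<open>1\<close>, tends to \<open>1\<close>, and \<open>m = 1\<close>.

  If \<open>b < a - 1\<close>, then \<open>f\<close> and hence \<open>F\<close> tends to \<open>0\<close>; so \<open>F\<close>, being positive for \<open>x > 0\<close>, attains a
  positive maximum, and that is \<open>m\<close>.
\<close>

section \<open>The size at which a growing cluster disappears\<close>

text \<open>
  The probability of growing to size \<open>i\<close> or beyond, when each size \<open>j\<close> is passed with probability
  \<open>x / (x + d j)\<close>.
\<close>

definition reach_prob :: "(nat \<Rightarrow> real) \<Rightarrow> real \<Rightarrow> nat \<Rightarrow> real" where
  "reach_prob d x i = (\<Prod>j<i. x / (x + d j))"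

definition exit_prob :: "(nat \<Rightarrow> real) \<Rightarrow> real \<Rightarrow> nat \<Rightarrow> real" where
  "exit_prob d x i = reach_prob d x i * (d i / (x + d i))"

definition exit_mean :: "(nat \<Rightarrow> real) \<Rightarrow> (nat \<Rightarrow> real) \<Rightarrow> real \<Rightarrow> real" where
  "exit_mean d f x = (\<Sum>i. f i * exit_prob d x i)"

text \<open>
  A uniform positive lower bound on the exit ratios makes the reach probabilities decay
  geometrically, so that clusters disappear almost surely and all the series below converge for
  every \<open>x \<ge> 0\<close>.
\<close>

locale growth_chain =
  fixes d :: "nat \<Rightarrow> real" and \<delta> :: real
  assumes \<delta>_pos: "\<delta> > 0" and d_ge: "\<And>i. d i \<ge> \<delta>"
begin

lemma d_pos: "d i > 0"
  using \<delta>_pos d_ge[of i] by linarith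

lemma reach_prob_nonneg: "x \<ge> 0 \<Longrightarrow> reach_prob d x i \<ge> 0"
  unfolding reach_prob_def using d_pos by (auto intro!: prod_nonneg divide_nonneg_pos add_nonneg_pos)

text \<open>
  The bound is uniform over \<open>0 \<le> x \<le> X\<close> because \<open>x / (x + d)\<close> increases with \<open>x\<close> and decreases with \<open>d\<close>;
  the uniformity is what later gives continuity in \<open>x\<close>.
\<close>

lemma reach_prob_le_power:
  assumes "0 \<le> x" "x \<le> X"
  shows "reach_prob d x i \<le> (X / (X + \<delta>)) ^ i"
proof -
  have "x / (x + d j) \<le> X / (X + \<delta>)" for j
  proof -
    have "x * \<delta> \<le> X * d j"
      using assms d_ge[of j] \<delta>_pos by (intro mult_mono) auto
    then show ?thesis
      using assms d_pos[of j] \<delta>_pos by (simp add: field_simps add_nonneg_pos)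
  qed
  then have "reach_prob d x i \<le> (\<Prod>j<i. X / (X + \<delta>))"
    unfolding reach_prob_def using assms d_pos
    by (intro prod_mono) (auto intro!: divide_nonneg_pos add_nonneg_pos)
  then show ?thesis by simp
qed

lemma reach_prob_le_1: "x \<ge> 0 \<Longrightarrow> reach_prob d x i \<le> 1"
  using reach_prob_le_power[of x x i] \<delta>_pos power_le_one[of "x / (x + \<delta>)" i] by simp

lemma exit_prob_nonneg: "x \<ge> 0 \<Longrightarrow> exit_prob d x i \<ge> 0"
  unfolding exit_prob_def using reach_prob_nonneg[of x i] d_pos[of i] by simp

lemma exit_prob_pos: "x > 0 \<Longrightarrow> exit_prob d x i > 0"
  unfolding exit_prob_def reach_prob_def using d_pos
  by (auto intro!: mult_pos_pos prod_pos divide_pos_pos add_pos_pos)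

lemma exit_prob_le_reach_prob:
  assumes "x \<ge> 0"
  shows "exit_prob d x i \<le> reach_prob d x i"
  using mult_left_mono[of "d i / (x + d i)" 1 "reach_prob d x i"] reach_prob_nonneg[OF assms, of i]
    d_pos[of i] assms by (simp add: exit_prob_def)

lemma exit_prob_le:
  assumes "x \<ge> 0"
  shows "exit_prob d x i \<le> d i / (x + d i)"
  using mult_right_mono[OF reach_prob_le_1[OF assms, of i], of "d i / (x + d i)"] d_pos[of i] assms
  by (simp add: exit_prob_def)

text \<open>
  Exiting at size \<open>i\<close> means reaching \<open>i\<close> but not its successor. This is what turns sums of exit
  probabilities into telescoping sums.
\<close>

lemma exit_prob_eq_diff:
  assumes "x \<ge> 0"
  shows "exit_prob d x i = reach_prob d x i - reach_prob d x (Suc i)"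
proof -
  have "d i / (x + d i) = 1 - x / (x + d i)"
    using assms d_pos[of i] by (simp add: field_simps)
  then have "exit_prob d x i = reach_prob d x i * (1 - x / (x + d i))"
    by (simp add: exit_prob_def)
  also have "\<dots> = reach_prob d x i - reach_prob d x (Suc i)"
    by (simp add: reach_prob_def right_diff_distrib)
  finally show ?thesis .
qed

lemma summable_mult_geometric:
  assumes "X \<ge> 0"
  shows "summable (\<lambda>i. real i * (X / (X + \<delta>)) ^ i)"
proof -
  let ?\<rho> = "X / (X + \<delta>)"
  have "summable (\<lambda>i. ?\<rho> * (real (Suc i) * ?\<rho> ^ i))"
    using geometric_deriv_sums[of ?\<rho>] assms \<delta>_pos by (intro summable_mult sums_summable) auto
  then have "summable (\<lambda>i. real (Suc i) * ?\<rho> ^ Suc i)"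
    by (simp add: mult_ac)
  then show ?thesis by (subst (asm) summable_Suc_iff)
qed

lemma summable_mult_reach_prob:
  assumes "x \<ge> 0"
  shows "summable (\<lambda>i. real i * reach_prob d x i)"
  using reach_prob_le_power[OF assms order_refl] reach_prob_nonneg[OF assms]
  by (intro summable_comparison_test[OF _ summable_mult_geometric[OF assms]])
    (auto intro!: mult_left_mono exI[of _ 0])

lemma summable_reach_prob_Suc:
  assumes "x \<ge> 0"
  shows "summable (\<lambda>i. reach_prob d x (Suc i))"
proof (rule summable_comparison_test)
  show "summable (\<lambda>i. real (Suc i) * reach_prob d x (Suc i))"
    using summable_mult_reach_prob[OF assms] by (subst summable_Suc_iff)
  show "\<exists>N. \<forall>n\<ge>N. norm (reach_prob d x (Suc n)) \<le> real (Suc n) * reach_prob d x (Suc n)"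
    using mult_right_mono[OF _ reach_prob_nonneg[OF assms], of 1 "real (Suc n)" "Suc n" for n]
      reach_prob_nonneg[OF assms] by (intro exI[of _ 0]) auto
qed

lemma exit_prob_sums_1:
  assumes "x \<ge> 0"
  shows "exit_prob d x sums 1"
proof -
  have "(\<lambda>i. reach_prob d x i) \<longlonglongrightarrow> 0"
    using summable_LIMSEQ_zero[OF summable_reach_prob_Suc[OF assms]] by (rule LIMSEQ_imp_Suc)
  from telescope_sums'[OF this]
  have "(\<lambda>i. reach_prob d x i - reach_prob d x (Suc i)) sums 1"
    by (simp add: reach_prob_def[of _ _ 0])
  then show ?thesis using exit_prob_eq_diff[OF assms] by (simp cong: sums_cong)
qed

text \<open>
  The tail formula for the mean of a random variable with values in the natural numbers. It is the
  identity behind the monomer balance: the right-hand side counts growth steps, each of which binds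
  one monomer.
\<close>

lemma mean_exit_sums:
  assumes "x \<ge> 0"
  shows "(\<lambda>i. real i * exit_prob d x i) sums (\<Sum>i. reach_prob d x (Suc i))"
proof -
  have parts: "(\<Sum>i<n. real i * exit_prob d x i)
      = (\<Sum>i<n. reach_prob d x (Suc i)) - real n * reach_prob d x n" for n
    by (induction n) (auto simp: exit_prob_eq_diff[OF assms] algebra_simps)
  show ?thesis
    unfolding sums_def parts
    using tendsto_diff[OF summable_LIMSEQ[OF summable_reach_prob_Suc[OF assms]]
        summable_LIMSEQ_zero[OF summable_mult_reach_prob[OF assms]]] by simp
qed

section \<open>The mean of a function of the exit size\<close>

lemma norm_weighted_exit_prob_le:
  assumes "\<And>i. \<bar>f i\<bar> \<le> real i" "0 \<le> x" "x \<le> X"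
  shows "norm (f i * exit_prob d x i) \<le> real i * (X / (X + \<delta>)) ^ i"
proof -
  have "exit_prob d x i \<le> (X / (X + \<delta>)) ^ i"
    using exit_prob_le_reach_prob[OF assms(2), of i] reach_prob_le_power[OF assms(2,3), of i]
    by linarith
  then show ?thesis
    using assms(1)[of i] exit_prob_nonneg[OF assms(2), of i]
    by (auto simp: abs_mult intro!: mult_mono)
qed

lemma summable_weighted_exit_prob:
  assumes "\<And>i. \<bar>f i\<bar> \<le> real i" "x \<ge> 0"
  shows "summable (\<lambda>i. f i * exit_prob d x i)"
  using norm_weighted_exit_prob_le[OF assms order_refl]
  by (intro summable_comparison_test[OF _ summable_mult_geometric[OF assms(2)]]) auto

lemma exit_mean_at_0: "exit_mean d f 0 = f 0"
proof -
  have "exit_prob d 0 i = (if i = 0 then 1 else 0)" for i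
    using d_pos[of 0] by (auto simp: exit_prob_def reach_prob_def)
  then have "(\<lambda>i. f i * exit_prob d 0 i) = (\<lambda>i. if i = 0 then f i else 0)"
    by auto
  then show ?thesis
    using sums_unique[OF sums_single[of 0 f]] by (simp add: exit_mean_def)
qed

lemma continuous_on_exit_mean:
  assumes "\<And>i. \<bar>f i\<bar> \<le> real i"
  shows "continuous_on {0..X} (exit_mean d f)"
proof (cases "X \<ge> 0")
  case True
  have unif: "uniform_limit {0..X} (\<lambda>n x. \<Sum>i<n. f i * exit_prob d x i)
      (\<lambda>x. \<Sum>i. f i * exit_prob d x i) sequentially"
    using norm_weighted_exit_prob_le[OF assms] summable_mult_geometric[OF True]
    by (intro Weierstrass_m_test) auto
  have frac: "continuous_on {0..X} (\<lambda>x. x / (x + d j))"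
      "continuous_on {0..X} (\<lambda>x. d j / (x + d j))" for j
    using d_pos[of j] by (auto intro!: continuous_on_divide continuous_on_add
        continuous_on_id continuous_on_const dest: add_nonneg_pos)
  have partial: "continuous_on {0..X} (\<lambda>x. \<Sum>i<n. f i * exit_prob d x i)" for n
    unfolding exit_prob_def reach_prob_def
    by (intro continuous_on_sum continuous_on_mult continuous_on_const continuous_on_prod frac)
  show ?thesis
    unfolding exit_mean_def
    by (rule uniform_limit_theorem[OF always_eventually[OF allI[OF partial]] unif sequentially_bot])
qed auto

lemma exit_mean_attains:
  assumes "\<And>i. \<bar>f i\<bar> \<le> real i" "X \<ge> 0" "0 \<le> y" "y \<le> exit_mean d f X"
  shows "\<exists>x\<ge>0. exit_mean d f x = y"
proof -
  have "f 0 = 0" using assms(1)[of 0] by simp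
  then have "exit_mean d f 0 \<le> y" using \<open>0 \<le> y\<close> by (simp add: exit_mean_at_0)
  from IVT'[OF this \<open>y \<le> exit_mean d f X\<close> \<open>X \<ge> 0\<close> continuous_on_exit_mean[OF assms(1)]]
  show ?thesis by blast
qed

lemma exit_mean_attains_if_eventually_greater:
  assumes f: "\<And>i. \<bar>f i\<bar> \<le> real i" and ev: "\<forall>\<^sub>F x in at_top. exit_mean d f x > y" and "y \<ge> 0"
  shows "\<exists>x\<ge>0. exit_mean d f x = y"
proof -
  obtain Z where Z: "\<And>x. x \<ge> Z \<Longrightarrow> exit_mean d f x > y"
    using ev by (auto simp: eventually_at_top_linorder)
  have "y \<le> exit_mean d f (max Z 0)"
    using Z[of "max Z 0"] by simp
  then show ?thesis
    by (rule exit_mean_attains[OF f _ \<open>y \<ge> 0\<close>, rotated]) simp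
qed

text \<open>
  For large \<open>x\<close> growth dominates at every given size, so the exit size escapes to infinity.
\<close>

lemma exit_prob_tendsto_0: "((\<lambda>x. exit_prob d x i) \<longlongrightarrow> 0) at_top"
proof (rule tendsto_sandwich)
  show "\<forall>\<^sub>F x in at_top. 0 \<le> exit_prob d x i"
    using eventually_ge_at_top[of 0] by eventually_elim (rule exit_prob_nonneg)
  show "\<forall>\<^sub>F x in at_top. exit_prob d x i \<le> d i / (x + d i)"
    using eventually_ge_at_top[of 0] by eventually_elim (rule exit_prob_le)
  show "((\<lambda>x. d i / (x + d i)) \<longlongrightarrow> 0) at_top" by real_asymp
qed simp

text \<open>
  The exit probabilities sum to \<open>1\<close>, so subtracting \<open>K\<close> from the mean subtracts it from \<open>f\<close>. The
  finitely many sizes at which \<open>f\<close> exceeds \<open>K\<close> then contribute an amount that vanishes as \<open>x\<close> grows. An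
  eventual bound on \<open>f\<close>, in place of a limit, lets this estimate and its mirror image cover finite
  and infinite limits alike.
\<close>

lemma exit_mean_eventually_less:
  assumes f: "\<And>i. \<bar>f i\<bar> \<le> real i"
    and K: "\<forall>\<^sub>F i in sequentially. f i \<le> K" and "K < L"
  shows "\<forall>\<^sub>F x in at_top. exit_mean d f x < L"
proof -
  obtain N where N: "\<And>i. i \<ge> N \<Longrightarrow> f i \<le> K"
    using K by (auto simp: eventually_sequentially)
  define g where "g x = (\<Sum>i<N. \<bar>f i - K\<bar> * exit_prob d x i)" for x
  have "(g \<longlongrightarrow> (\<Sum>i<N. \<bar>f i - K\<bar> * 0)) at_top"
    unfolding g_def by (intro tendsto_intros exit_prob_tendsto_0)
  then have small: "\<forall>\<^sub>F x in at_top. g x < L - K"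
    using \<open>K < L\<close> by (intro order_tendstoD) auto
  show ?thesis
    using small eventually_ge_at_top[of 0]
  proof eventually_elim
    case (elim x)
    have sums: "(\<lambda>i. (f i - K) * exit_prob d x i) sums (exit_mean d f x - K)"
      using sums_diff[OF summable_sums[OF summable_weighted_exit_prob[OF f elim(2)]]
          sums_mult[OF exit_prob_sums_1[OF elim(2)], of K]]
      by (simp add: exit_mean_def algebra_simps)
    have g_sums: "(\<lambda>i. if i \<in> {..<N} then \<bar>f i - K\<bar> * exit_prob d x i else 0) sums g x"
      unfolding g_def by (rule sums_If_finite_set) simp
    have le: "(f i - K) * exit_prob d x i
        \<le> (if i \<in> {..<N} then \<bar>f i - K\<bar> * exit_prob d x i else 0)" for i
    proof (cases "i < N")
      case True
      then show ?thesis
        using mult_right_mono[OF abs_ge_self exit_prob_nonneg[OF elim(2)]] by simp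
    next
      case False
      then show ?thesis
        using N[of i] exit_prob_nonneg[OF elim(2), of i] by (simp add: mult_nonpos_nonneg)
    qed
    have "exit_mean d f x - K \<le> g x"
      by (rule sums_le[OF le sums g_sums])
    with elim show ?case by linarith
  qed
qed

lemma exit_mean_eventually_greater:
  assumes f: "\<And>i. \<bar>f i\<bar> \<le> real i"
    and K: "\<forall>\<^sub>F i in sequentially. f i \<ge> K" and "L < K"
  shows "\<forall>\<^sub>F x in at_top. exit_mean d f x > L"
proof -
  have "\<forall>\<^sub>F x in at_top. exit_mean d (\<lambda>i. - f i) x < - L"
    using assms by (intro exit_mean_eventually_less[of _ "- K"]) auto
  then show ?thesis
    using eventually_ge_at_top[of 0]
  proof eventually_elim
    case (elim x)
    have "exit_mean d (\<lambda>i. - f i) x = - exit_mean d f x"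
      using suminf_minus[OF summable_weighted_exit_prob[OF f elim(2)]] by (simp add: exit_mean_def)
    with elim show ?case by simp
  qed
qed

section \<open>Values taken by the mean\<close>

lemma exit_mean_range_unbounded:
  assumes f: "\<And>i. \<bar>f i\<bar> \<le> real i" and lim: "filterlim f at_top sequentially" and "y \<ge> 0"
  shows "\<exists>x\<ge>0. exit_mean d f x = y"
proof -
  have "\<forall>\<^sub>F i in sequentially. f i \<ge> y + 1"
    using lim by (simp add: filterlim_at_top)
  then have "\<forall>\<^sub>F x in at_top. exit_mean d f x > y"
    by (rule exit_mean_eventually_greater[OF f]) auto
  then show ?thesis
    by (rule exit_mean_attains_if_eventually_greater[OF f _ \<open>y \<ge> 0\<close>])
qed

text \<open>
  A mean of values below \<open>m\<close> is below \<open>m\<close>, strictly because size \<open>0\<close> is an exit size of positive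
  probability for every \<open>x \<ge> 0\<close>. All nonnegative values below \<open>m\<close> are taken because the mean starts from \<open>f 0 = 0\<close>
  and tends to \<open>m\<close>.
\<close>

lemma exit_mean_range_limit_not_attained:
  assumes f: "\<And>i. \<bar>f i\<bar> \<le> real i" and lim: "f \<longlonglongrightarrow> m" and below: "\<And>i. f i < m" and "y \<ge> 0"
  shows "(\<exists>x\<ge>0. exit_mean d f x = y) \<longleftrightarrow> y < m"
proof
  assume "\<exists>x\<ge>0. exit_mean d f x = y"
  then obtain x where x: "x \<ge> 0" "exit_mean d f x = y" by auto
  have sums: "(\<lambda>i. (m - f i) * exit_prob d x i) sums (m - exit_mean d f x)"
    using sums_diff[OF sums_mult[OF exit_prob_sums_1[OF x(1)], of m]
        summable_sums[OF summable_weighted_exit_prob[OF f x(1)]]]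
    by (simp add: exit_mean_def algebra_simps)
  have "0 < (m - f 0) * exit_prob d x 0"
    using below[of 0] x(1) d_pos[of 0] by (simp add: exit_prob_def reach_prob_def)
  then have "0 < (\<Sum>i. (m - f i) * exit_prob d x i)"
    using sums below exit_prob_nonneg[OF x(1)]
    by (intro suminf_pos2[of _ 0]) (auto simp: sums_iff less_imp_le)
  then show "y < m" using sums x by (simp add: sums_iff)
next
  assume "y < m"
  then obtain K where K: "y < K" "K < m" using dense by blast
  have "\<forall>\<^sub>F i in sequentially. f i \<ge> K"
    using order_tendstoD(1)[OF lim K(2)] by eventually_elim simp
  then have "\<forall>\<^sub>F x in at_top. exit_mean d f x > y"
    by (rule exit_mean_eventually_greater[OF f _ K(1)])
  then show "\<exists>x\<ge>0. exit_mean d f x = y"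
    by (rule exit_mean_attains_if_eventually_greater[OF f _ \<open>y \<ge> 0\<close>])
qed

text \<open>
  The mean is positive at \<open>x = 1\<close> and tends to \<open>0\<close>. So beyond some point it stays below its value
  at \<open>1\<close>, and its maximum over the compact interval up to that point is a global one.
\<close>

lemma exit_mean_range_maximum_attained:
  assumes f: "\<And>i. \<bar>f i\<bar> \<le> real i" and nonneg: "\<And>i. f i \<ge> 0" and "f n > 0"
    and lim: "f \<longlonglongrightarrow> 0"
  shows "\<exists>m>0. \<forall>y\<ge>0. (\<exists>x\<ge>0. exit_mean d f x = y) \<longleftrightarrow> y \<le> m"
proof -
  let ?F = "exit_mean d f"
  have F1: "?F 1 > 0"
    unfolding exit_mean_def
  proof (rule suminf_pos2)
    show "summable (\<lambda>i. f i * exit_prob d 1 i)"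
      by (rule summable_weighted_exit_prob[OF f]) simp
    show "f i * exit_prob d 1 i \<ge> 0" for i
      using nonneg[of i] exit_prob_nonneg[of 1 i] by simp
    show "f n * exit_prob d 1 n > 0"
      using \<open>f n > 0\<close> exit_prob_pos[of 1 n] by simp
  qed
  have "\<forall>\<^sub>F i in sequentially. f i \<le> ?F 1 / 2"
    using order_tendstoD(2)[OF lim, of "?F 1 / 2"] F1 by (auto elim: eventually_mono)
  then have "\<forall>\<^sub>F x in at_top. ?F x < ?F 1"
    using F1 by (intro exit_mean_eventually_less[OF f, of "?F 1 / 2"]) auto
  then obtain X where X: "\<And>x. x \<ge> X \<Longrightarrow> ?F x < ?F 1"
    by (auto simp: eventually_at_top_linorder)
  define Y where "Y = max X 1"
  obtain z where z: "z \<in> {0..Y}" and max: "\<And>x. x \<in> {0..Y} \<Longrightarrow> ?F x \<le> ?F z"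
    using continuous_attains_sup[OF compact_Icc _ continuous_on_exit_mean[OF f], of Y]
    by (fastforce simp: Y_def)
  have F1z: "?F 1 \<le> ?F z" using max[of 1] by (simp add: Y_def)
  have "?F x \<le> ?F z" if "x \<ge> 0" for x
  proof (cases "x \<le> Y")
    case True
    then show ?thesis using that max[of x] by simp
  next
    case False
    then have "x \<ge> X" by (simp add: Y_def)
    with X F1z show ?thesis by fastforce
  qed
  moreover have "?F z > 0" using F1 F1z by simp
  ultimately show ?thesis
    using exit_mean_attains[OF f, of z] z by (intro exI[of _ "?F z"]) auto
qed

end

section \<open>Equilibria as solutions of a scalar equation\<close>

text \<open>
  The cluster equations determine \<open>M\<close> recursively from \<open>x\<close>. The natural unknown is \<open>k i * M i\<close>, since
  for it the total loss rate at size \<open>i\<close> is \<open>x + d i\<close> and the rate of growth to the next size is \<open>x\<close>.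
\<close>

lemma M_rhs_eq_0_iff:
  fixes k p q :: "nat \<Rightarrow> real"
  defines "d \<equiv> \<lambda>i. (p i + q i) / k i"
  assumes k: "\<And>i. k i > 0" and pq: "\<And>i. p i + q i > 0" and "x \<ge> 0"
  shows "(\<forall>i. M_rhs r k p q M x i = 0) \<longleftrightarrow> (\<forall>i. k i * M i = r * reach_prob d x i / (x + d i))"
proof -
  have pos: "x + d i > 0" for i using assms by (simp add: d_def add_nonneg_pos)
  have loss: "k i * x * M i + (p i + q i) * M i = (x + d i) * (k i * M i)" for i
    using k[of i] by (simp add: d_def field_simps)
  have rhs_0: "M_rhs r k p q M x 0 = r - (x + d 0) * (k 0 * M 0)"
    using loss[of 0] by (simp add: M_rhs_def algebra_simps)
  have rhs_Suc: "M_rhs r k p q M x (Suc i) = x * (k i * M i) - (x + d (Suc i)) * (k (Suc i) * M (Suc i))" for i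
    using loss[of "Suc i"] by (simp add: M_rhs_def algebra_simps)
  have reach_Suc: "reach_prob d x (Suc i) = x * (reach_prob d x i / (x + d i))" for i
    by (simp add: reach_prob_def)
  show ?thesis
  proof (intro iffI allI)
    fix i assume zero: "\<forall>i. M_rhs r k p q M x i = 0"
    show "k i * M i = r * reach_prob d x i / (x + d i)"
    proof (induction i)
      case 0
      show ?case using zero[rule_format, of 0] pos[of 0]
        by (simp add: rhs_0 field_simps reach_prob_def)
    next
      case (Suc i)
      have "(x + d (Suc i)) * (k (Suc i) * M (Suc i)) = r * reach_prob d x (Suc i)"
        using zero[rule_format, of "Suc i"] Suc by (simp add: rhs_Suc reach_Suc mult.left_commute)
      then show ?case using pos[of "Suc i"] by (simp add: field_simps)
    qed
  next
    fix i assume M: "\<forall>i. k i * M i = r * reach_prob d x i / (x + d i)"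
    show "M_rhs r k p q M x i = 0"
    proof (cases i)
      case 0
      then show ?thesis using pos[of 0] by (simp add: rhs_0 M reach_prob_def)
    next
      case (Suc j)
      then show ?thesis using pos[of "Suc j"] by (simp add: rhs_Suc M reach_Suc)
    qed
  qed
qed

text \<open>
  Once \<open>M\<close> solves the cluster equations, the monomer uptake \<open>x * (\<Sum>i. k i * M i)\<close> is \<open>r\<close> times the mean
  exit size, by the tail formula. The monomers given back are \<open>r\<close> times the mean of
  \<open>i * q i / (p i + q i)\<close>, and the difference of these two is \<open>r\<close> times the mean of
  \<open>f i = i * p i / (p i + q i)\<close>. The exit ratios are bounded below and the
  exit size has a finite mean, so both series converge for every \<open>x \<ge> 0\<close>, and summability does not
  restrict the equilibria.
\<close>

lemma has_equilibrium_iff: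
  fixes k p q :: "nat \<Rightarrow> real"
  defines "d \<equiv> \<lambda>i. (p i + q i) / k i"
    and "f \<equiv> \<lambda>i. real i * p i / (p i + q i)"
  assumes k: "\<And>i. k i > 0" and p: "\<And>i. p i \<ge> 0" and q: "\<And>i. q i \<ge> 0"
    and chain: "growth_chain d \<delta>" and "r > 0"
  shows "has_equilibrium \<alpha> r k p q \<longleftrightarrow> (\<exists>x\<ge>0. exit_mean d f x = \<alpha> / r)"
proof -
  interpret growth_chain d \<delta> by (rule chain)
  have pq: "p i + q i > 0" for i
    using d_pos[of i] k[of i] by (simp add: d_def zero_less_divide_iff)
  have balance: "summable (\<lambda>i. k i * M i) \<and> summable (\<lambda>i. real i * q i * M i)
      \<and> x_rhs \<alpha> k q M x = \<alpha> - r * exit_mean d f x"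
    if x: "x \<ge> 0" and M: "\<And>i. k i * M i = r * reach_prob d x i / (x + d i)" for x M
  proof -
    let ?e = "exit_prob d x"
    have pos: "x + d i > 0" for i using x d_pos[of i] by simp
    have kM: "k i * M i = r * (?e i / d i)" for i
      using d_pos[of i] by (simp add: M exit_prob_def)
    have "norm (?e i / d i) \<le> ?e i / \<delta>" for i
      using exit_prob_nonneg[OF x, of i] d_pos[of i] d_ge[of i] \<delta>_pos
      by (auto intro!: divide_left_mono)
    then have "summable (\<lambda>i. ?e i / d i)"
      using summable_divide[OF sums_summable[OF exit_prob_sums_1[OF x]], of \<delta>]
      by (intro summable_comparison_test[of "\<lambda>i. ?e i / d i" "\<lambda>i. ?e i / \<delta>"]) auto
    then have summable_kM: "summable (\<lambda>i. k i * M i)"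
      unfolding kM by (rule summable_mult)
    have "x * (k i * M i) = r * reach_prob d x (Suc i)" for i
      by (simp add: M reach_prob_def)
    then have growth: "x * (\<Sum>i. k i * M i) = r * (\<Sum>i. real i * ?e i)"
      using suminf_mult[OF summable_kM, of x] suminf_mult[OF summable_reach_prob_Suc[OF x], of r]
        sums_unique[OF mean_exit_sums[OF x]] by simp
    have f: "\<bar>f i\<bar> \<le> real i" for i
      using p[of i] q[of i] pq[of i] mult_left_mono[of "p i" "p i + q i" "real i"]
      by (simp add: f_def divide_le_eq)
    have release: "real i * q i * M i = r * (real i * ?e i - f i * ?e i)" for i
    proof -
      have "k i * (real i * q i * M i) = real i * q i * (k i * M i)" by simp
      also have "\<dots> = k i * (r * (real i - f i) * ?e i)"
        using k[of i] pq[of i] unfolding kM by (simp add: f_def d_def field_simps)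
      finally have "real i * q i * M i = r * (real i - f i) * ?e i"
        using k[of i] by simp
      then show ?thesis by (simp add: algebra_simps)
    qed
    have "(\<lambda>i. real i * q i * M i) sums (r * ((\<Sum>i. real i * ?e i) - exit_mean d f x))"
      unfolding release exit_mean_def
      by (intro sums_mult sums_diff summable_sums summable_weighted_exit_prob f x) simp
    then show ?thesis
      using summable_kM growth by (simp add: x_rhs_def sums_iff algebra_simps)
  qed
  show ?thesis
  proof
    assume "has_equilibrium \<alpha> r k p q"
    then obtain M x where eq: "is_equilibrium \<alpha> r k p q M x"
      by (auto simp: has_equilibrium_def)
    then have x: "x \<ge> 0" by (simp add: is_equilibrium_def)
    have "k i * M i = r * reach_prob d x i / (x + d i)" for i
      using eq M_rhs_eq_0_iff[of k p q x r M, OF k pq x] by (simp add: is_equilibrium_def d_def)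
    from balance[OF x this] eq have "exit_mean d f x = \<alpha> / r"
      using \<open>r > 0\<close> by (simp add: is_equilibrium_def field_simps)
    with x show "\<exists>x\<ge>0. exit_mean d f x = \<alpha> / r" by blast
  next
    assume "\<exists>x\<ge>0. exit_mean d f x = \<alpha> / r"
    then obtain x where x: "x \<ge> 0" "exit_mean d f x = \<alpha> / r" by blast
    define M where "M i = r * reach_prob d x i / (x + d i) / k i" for i
    have M: "k i * M i = r * reach_prob d x i / (x + d i)" for i
      using k[of i] by (simp add: M_def)
    have "M_rhs r k p q M x i = 0" for i
      using M_rhs_eq_0_iff[of k p q x r M, OF k pq x(1)] M by (simp add: d_def)
    then have "is_equilibrium \<alpha> r k p q M x"
      using balance[OF x(1) M] x \<open>r > 0\<close> by (simp add: is_equilibrium_def)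
    then show "has_equilibrium \<alpha> r k p q" by (auto simp: has_equilibrium_def)
  qed
qed

section \<open>Power-law rates\<close>

theorem corollary7:
  fixes p q k a b :: real
    and ps qs ks :: "nat \<Rightarrow> real"
  assumes "p \<ge> 0" and "q \<ge> 0" and "k \<ge> 0"
    and "\<And>i. i \<ge> 1 \<Longrightarrow> ps i = real i powr (- p)"
    and "\<And>i. i \<ge> 1 \<Longrightarrow> qs i = real i powr q"
    and "\<And>i. i \<ge> 1 \<Longrightarrow> ks i = real i powr (- k)"
    and "ps 0 \<ge> 0" and "qs 0 \<ge> 0" and "ks 0 > 0" and "ps 0 + qs 0 > 0"
    and "a = q + k" and "b = k - p"
    and "a \<ge> 0" and "b > -2"
  shows "(b > a - 1 \<longrightarrow> (\<forall>\<alpha>>0. \<forall>r>0. has_equilibrium \<alpha> r ks ps qs))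
    \<and> (b = a - 1 \<longrightarrow> (\<exists>m>0. \<forall>\<alpha>>0. \<forall>r>0.
          (\<alpha> / r < m \<longrightarrow> has_equilibrium \<alpha> r ks ps qs) \<and>
          (\<alpha> / r \<ge> m \<longrightarrow> \<not> has_equilibrium \<alpha> r ks ps qs)))
    \<and> (b < a - 1 \<longrightarrow> (\<exists>m>0. \<forall>\<alpha>>0. \<forall>r>0.
          (\<alpha> / r \<le> m \<longrightarrow> has_equilibrium \<alpha> r ks ps qs) \<and>
          (\<alpha> / r > m \<longrightarrow> \<not> has_equilibrium \<alpha> r ks ps qs)))"
proof -
  define d where "d i = (ps i + qs i) / ks i" for i
  define f where "f i = real i * ps i / (ps i + qs i)" for i
  have ks: "ks i > 0" and ps: "ps i \<ge> 0" and qs: "qs i \<ge> 0" for i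
    using assms by (cases "i = 0"; simp)+
  have d: "d i = real i powr a + real i powr b" if "i \<ge> 1" for i
    using that assms by (simp add: d_def add_divide_distrib flip: powr_diff)
  \<comment> \<open>Cancelling \<open>real i powr (b + 1)\<close> leaves a form from which the limit in each of the three cases
    can be read off: the sign of \<open>a - b - 1\<close> alone decides it.\<close>
  have f: "f i = 1 / (real i powr (a - b - 1) + 1 / real i)" if "i \<ge> 1" for i
  proof -
    have "f i = real i * (ps i / ks i) / d i"
      using ks[of i] by (simp add: f_def d_def)
    also have "ps i / ks i = real i powr b"
      using that assms by (simp flip: powr_diff)
    also have "real i * real i powr b / d i
        = 1 / (real i powr a / real i powr b / real i + 1 / real i)"
      using that by (simp add: d field_simps)
    also have "real i powr a / real i powr b / real i = real i powr (a - b - 1)"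
      using that by (simp add: powr_diff)
    finally show ?thesis .
  qed
  \<comment> \<open>As \<open>a \<ge> 0\<close>, every exit ratio with positive index is at least \<open>1\<close>.\<close>
  have "d i \<ge> min (d 0) 1" for i
  proof (cases "i = 0")
    case False
    then have "real i powr a \<ge> 1" using \<open>a \<ge> 0\<close> by (intro ge_one_powr_ge_zero) auto
    with d[of i] False show ?thesis by (simp add: min_le_iff_disj add_increasing2)
  qed simp
  moreover have "d 0 > 0" using assms by (simp add: d_def)
  ultimately interpret growth_chain d "min (d 0) 1" by unfold_locales auto
  have equilibrium: "has_equilibrium \<alpha> r ks ps qs \<longleftrightarrow> (\<exists>x\<ge>0. exit_mean d f x = \<alpha> / r)"
    if "r > 0" for \<alpha> r
    using has_equilibrium_iff[of ks ps qs, OF ks ps qs _ that] growth_chain_axioms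
    unfolding d_def[abs_def] f_def[abs_def] by blast
  have f_nonneg: "f i \<ge> 0" for i using ps[of i] qs[of i] by (simp add: f_def)
  have f_le: "\<bar>f i\<bar> \<le> real i" for i
    using ps[of i] qs[of i] mult_left_mono[of "ps i" "ps i + qs i" "real i"]
    by (cases "ps i + qs i = 0") (auto simp: f_def divide_le_eq)
  have f_eventually: "\<forall>\<^sub>F i in sequentially.
      f i = 1 / (real i powr (a - b - 1) + 1 / real i)"
    using eventually_ge_at_top[of 1] by eventually_elim (rule f)
  show ?thesis
  proof (intro conjI impI)
    assume "b > a - 1"
    \<comment> \<open>The two vanishing terms in the denominator compare differently according to the sign of
      \<open>a - b\<close>; inverting their sum avoids that case distinction.\<close>
    then have neg: "a - b - 1 < 0" by simp
    have "((\<lambda>i. real i powr (a - b - 1) + 1 / real i) \<longlongrightarrow> 0) sequentially"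
      using tendsto_add[OF tendsto_neg_powr[OF neg filterlim_real_sequentially] lim_1_over_n] by simp
    moreover have "\<forall>\<^sub>F i in sequentially. real i powr (a - b - 1) + 1 / real i > 0"
      using eventually_ge_at_top[of 1] by eventually_elim (simp add: add_nonneg_pos)
    ultimately have "filterlim (\<lambda>i. 1 / (real i powr (a - b - 1) + 1 / real i)) at_top sequentially"
      using filterlim_inverse_at_top by (simp add: inverse_eq_divide)
    then have "filterlim f at_top sequentially"
      by (subst filterlim_cong[OF refl refl f_eventually])
    then show "\<forall>\<alpha>>0. \<forall>r>0. has_equilibrium \<alpha> r ks ps qs"
      using exit_mean_range_unbounded[OF f_le] by (simp add: equilibrium)
  next
    assume b: "b = a - 1"
    have f_eq: "f i = real i / (real i + 1)" for i
    proof (cases "i = 0")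
      case False
      then show ?thesis using f[of i] by (simp add: b field_simps)
    qed (simp add: f_def)
    have "f \<longlonglongrightarrow> 1" unfolding f_eq by real_asymp
    moreover have "f i < 1" for i by (simp add: f_eq)
    ultimately have "(\<exists>x\<ge>0. exit_mean d f x = y) \<longleftrightarrow> y < 1" if "y \<ge> 0" for y
      using exit_mean_range_limit_not_attained[OF f_le _ _ that] by blast
    then show "\<exists>m>0. \<forall>\<alpha>>0. \<forall>r>0.
        (\<alpha> / r < m \<longrightarrow> has_equilibrium \<alpha> r ks ps qs) \<and>
        (\<alpha> / r \<ge> m \<longrightarrow> \<not> has_equilibrium \<alpha> r ks ps qs)"
      by (intro exI[of _ 1]) (simp add: equilibrium)
  next
    assume "b < a - 1"
    then have "(\<lambda>i. 1 / (real i powr (a - b - 1) + 1 / real i)) \<longlonglongrightarrow> 0"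
      by real_asymp
    then have "f \<longlonglongrightarrow> 0"
      by (subst filterlim_cong[OF refl refl f_eventually])
    moreover have "f 1 > 0" by (simp add: f)
    ultimately obtain m where "m > 0"
      and m: "\<And>y. y \<ge> 0 \<Longrightarrow> (\<exists>x\<ge>0. exit_mean d f x = y) \<longleftrightarrow> y \<le> m"
      using exit_mean_range_maximum_attained[OF f_le f_nonneg, of 1] by blast
    then show "\<exists>m>0. \<forall>\<alpha>>0. \<forall>r>0.
        (\<alpha> / r \<le> m \<longrightarrow> has_equilibrium \<alpha> r ks ps qs) \<and>
        (\<alpha> / r > m \<longrightarrow> \<not> has_equilibrium \<alpha> r ks ps qs)"
      by (intro exI[of _ m]) (simp add: equilibrium)
  qed
qed

end
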